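(* Let $G$ be an $(n,d,\lambda)$-graph and $U$ a subset of vertices with $n\lambda/d=o(|U|)$. Then there is a subset $U'\subset U$ of size $(1-o(1))|U|$ such that \[H_3^-(U')\ll \frac{|U'|^6d^7}{n^7}+\lambda^2\frac{|U'|^4d^4}{n^4}+\lambda\frac{|U'|^5d^5}{n^5}+\lambda^2\frac{|U'|^4d^{7/2}}{n^{7/2}}+\lambda^3\frac{|U'|^3d^{5/2}}{n^{5/2}}+\lambda^4\frac{|U'|^2d}{n}.\]
   Context: An $(n,d,\lambda)$-graph is a $d$-regular graph on $n$ vertices all of whose adjacency eigenvalues other than the largest have absolute value at most $\lambda$; $u\sim v$ denotes adjacency. For $W\subset V(G)$, $H_3^-(W)$ is the number of $6$-tuples $(x,y,z,u,v,x')\in W^6$ (not necessarily distinct) with $x\sim y$, $y\sim z$, $z\sim u$, $u\sim x$, $x\sim x'$, $x'\sim y$, $x\sim v$, $v\sim u$, $x\sim z$. Asymptotic notation refers to $n\to\infty$; $f\ll g$ means $f=O(g)$. *)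

theory Defs
  imports
    "HOL-Library.Landau_Symbols"
    "Graph_Theory.Pair_Digraph"
    "Jordan_Normal_Form.Char_Poly"
begin

definition adjacency_mat :: "'a pair_pre_digraph \<Rightarrow> 'a list \<Rightarrow> real mat" where
  "adjacency_mat G vs =
     mat (length vs) (length vs) (\<lambda>(i, j). if vs ! i \<rightarrow>\<^bsub>G\<^esub> vs ! j then 1 else 0)"

text \<open>The eigenvalues with multiplicity. Two enumerations of the vertices give
  permutation-similar matrices, so the characteristic polynomial does not depend on the choice;
  for a symmetric graph all its complex roots are real, so no eigenvalue is lost.\<close>

definition adjacency_eigenvalues :: "'a pair_pre_digraph \<Rightarrow> real multiset" where
  "adjacency_eigenvalues G =
     proots (char_poly (adjacency_mat G (SOME vs. distinct vs \<and> set vs = pverts G)))"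

text \<open>Only one copy of the largest eigenvalue is exempt from the bound: if its multiplicity
  exceeds one, the remaining copies are bounded by \<open>l\<close> as well.\<close>

definition ndl_graph :: "nat \<Rightarrow> nat \<Rightarrow> real \<Rightarrow> 'a pair_pre_digraph \<Rightarrow> bool" where
  "ndl_graph n d l G \<longleftrightarrow>
     pair_graph G \<and> card (pverts G) = n \<and>
     (\<forall>v\<in>pverts G. out_degree (with_proj G) v = d) \<and>
     (\<forall>\<mu>\<in>#adjacency_eigenvalues G - {#Max_mset (adjacency_eigenvalues G)#}. \<bar>\<mu>\<bar> \<le> l)"

definition H3_minus :: "'a pair_pre_digraph \<Rightarrow> 'a set \<Rightarrow> nat" where
  "H3_minus G W = card {(x, y, z, u, v, x').
     x \<in> W \<and> y \<in> W \<and> z \<in> W \<and> u \<in> W \<and> v \<in> W \<and> x' \<in> W \<and>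
     x \<rightarrow>\<^bsub>G\<^esub> y \<and> y \<rightarrow>\<^bsub>G\<^esub> z \<and> z \<rightarrow>\<^bsub>G\<^esub> u \<and> u \<rightarrow>\<^bsub>G\<^esub> x \<and>
     x \<rightarrow>\<^bsub>G\<^esub> x' \<and> x' \<rightarrow>\<^bsub>G\<^esub> y \<and> x \<rightarrow>\<^bsub>G\<^esub> v \<and> v \<rightarrow>\<^bsub>G\<^esub> u \<and> x \<rightarrow>\<^bsub>G\<^esub> z}"

end

theory Submission
  imports Defs "HOL-Analysis.Convex" "HOL-Analysis.Function_Topology"
begin

text \<open>
  \<open>H3_minus\<close> counts a hub \<open>x\<close> together with a walk \<open>x', y, z, u, v\<close> of length four inside the
  neighbourhood \<open>S\<close> of \<open>x\<close>, so the contribution of \<open>x\<close> is the squared norm of \<open>A\<^sub>S\<^sup>2 1\<close>, where \<open>A\<^sub>S\<close>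
  is the adjacency matrix restricted to \<open>S\<close>. Since \<open>A - (d / n) J\<close> has norm at most \<open>l\<close>, the norm
  of \<open>A\<^sub>S\<close> is at most \<open>d |S| / n + l\<close>. Deleting from \<open>U\<close> the vertices with more than \<open>2 d |U| / n\<close>
  neighbours in \<open>U\<close> removes only \<open>o(|U|)\<close> of them, by the same norm bound applied to the indicator
  of \<open>U\<close>. For the remaining set, of size \<open>m\<close>, all neighbourhoods have size \<open>O(d m / n)\<close>, and the
  count is \<open>O((d m\<^sup>2 / n) (d\<^sup>2 m / n\<^sup>2 + l)\<^sup>4)\<close>, which the first and last terms dominate.
\<close>

section \<open>Extrema and norms of symmetric quadratic forms\<close>

text \<open>By Tychonoff, since the unit sphere is a closed part of a product of compact sets. The
  index set \<open>V\<close> is arbitrary and finite, so vectors are functions, pinned to 0 outside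
  \<open>V\<close> to keep the remaining coordinates bounded.\<close>

lemma compact_sphere_fun:
  fixes V :: "'b set"
  assumes "finite V"
  shows "compact {f :: 'b \<Rightarrow> real. (\<Sum>i\<in>V. (f i)\<^sup>2) = 1 \<and> (\<forall>i. i \<notin> V \<longrightarrow> f i = 0)}" (is "compact ?K")
proof -
  let ?B = "PiE UNIV (\<lambda>i. if i \<in> V then {-1..1} else {0::real})"
  have "compactin (product_topology (\<lambda>i. euclidean) UNIV) ?B"
    by (subst compactin_PiE) auto
  then have "compact ?B"
    by (simp add: euclidean_product_topology)
  moreover have "closed {f :: 'b \<Rightarrow> real. (\<Sum>i\<in>V. (f i)\<^sup>2) = 1}"
    by (intro closed_Collect_eq continuous_intros continuous_on_product_coordinates)
  ultimately have "compact (?B \<inter> {f :: 'b \<Rightarrow> real. (\<Sum>i\<in>V. (f i)\<^sup>2) = 1})"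
    by (rule compact_Int_closed)
  moreover have "?K = ?B \<inter> {f :: 'b \<Rightarrow> real. (\<Sum>i\<in>V. (f i)\<^sup>2) = 1}"
  proof -
    have "\<bar>f i\<bar> \<le> 1" if "(\<Sum>i\<in>V. (f i)\<^sup>2) = 1" "i \<in> V" for f :: "'b \<Rightarrow> real" and i
    proof -
      have "(f i)\<^sup>2 \<le> 1"
        using member_le_sum[of i V "\<lambda>i. (f i)\<^sup>2"] that assms by auto
      then show ?thesis
        by (simp add: abs_square_le_1)
    qed
    then show ?thesis
      by (fastforce simp: PiE_iff abs_le_iff split: if_splits)
  qed
  ultimately show ?thesis by simp
qed

text \<open>Symmetry merges the two cross terms of the expansion along a line. The formula serves
  both the first variation at a maximiser and the polarisation argument.\<close>

lemma symmetric_form_add: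
  fixes M :: "'b \<Rightarrow> 'b \<Rightarrow> real"
  assumes "\<And>i j. i \<in> V \<Longrightarrow> j \<in> V \<Longrightarrow> M i j = M j i"
  shows "(\<Sum>i\<in>V. \<Sum>j\<in>V. M i j * (f i + t * h i) * (f j + t * h j)) =
    (\<Sum>i\<in>V. \<Sum>j\<in>V. M i j * f i * f j) + 2 * t * (\<Sum>i\<in>V. h i * (\<Sum>j\<in>V. M i j * f j))
    + t\<^sup>2 * (\<Sum>i\<in>V. \<Sum>j\<in>V. M i j * h i * h j)"
proof -
  have "(\<Sum>i\<in>V. \<Sum>j\<in>V. M i j * f i * h j) = (\<Sum>j\<in>V. \<Sum>i\<in>V. M i j * f i * h j)"
    by (rule sum.swap)
  also have "\<dots> = (\<Sum>i\<in>V. h i * (\<Sum>j\<in>V. M i j * f j))"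
    unfolding sum_distrib_left using assms by (intro sum.cong refl) (simp add: mult_ac)
  finally have sw: "(\<Sum>i\<in>V. \<Sum>j\<in>V. M i j * f i * h j) = (\<Sum>i\<in>V. h i * (\<Sum>j\<in>V. M i j * f j))" .
  have "(\<Sum>i\<in>V. \<Sum>j\<in>V. M i j * (f i + t * h i) * (f j + t * h j)) =
    (\<Sum>i\<in>V. \<Sum>j\<in>V. M i j * f i * f j + t * (h i * (M i j * f j)) + t * (M i j * f i * h j)
      + t\<^sup>2 * (M i j * h i * h j))"
    by (intro sum.cong refl) (simp add: algebra_simps power2_eq_square)
  also have "\<dots> = (\<Sum>i\<in>V. \<Sum>j\<in>V. M i j * f i * f j) + t * (\<Sum>i\<in>V. h i * (\<Sum>j\<in>V. M i j * f j))
     + t * (\<Sum>i\<in>V. \<Sum>j\<in>V. M i j * f i * h j) + t\<^sup>2 * (\<Sum>i\<in>V. \<Sum>j\<in>V. M i j * h i * h j)"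
    by (simp only: sum.distrib sum_distrib_left)
  finally show ?thesis unfolding sw by simp
qed

text \<open>Rayleigh's principle: the form attains its maximum on the compact unit sphere, and a
  maximiser is a critical point, hence an eigenvector. Applied to a matrix and to its negative, this
  controls both ends of the spectrum without a full diagonalisation.\<close>

lemma symmetric_form_max_eigenvector:
  fixes M :: "'b \<Rightarrow> 'b \<Rightarrow> real"
  assumes fin: "finite V" and ne: "V \<noteq> {}"
    and sym: "\<And>i j. i \<in> V \<Longrightarrow> j \<in> V \<Longrightarrow> M i j = M j i"
  obtains s f where "\<exists>i\<in>V. f i \<noteq> 0" "\<And>i. i \<in> V \<Longrightarrow> (\<Sum>j\<in>V. M i j * f j) = s * f i"
    "\<And>g. (\<Sum>i\<in>V. \<Sum>j\<in>V. M i j * g i * g j) \<le> s * (\<Sum>i\<in>V. (g i)\<^sup>2)"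
proof -
  define K where "K = {f :: 'b \<Rightarrow> real. (\<Sum>i\<in>V. (f i)\<^sup>2) = 1 \<and> (\<forall>i. i \<notin> V \<longrightarrow> f i = 0)}"
  define Q where "Q f = (\<Sum>i\<in>V. \<Sum>j\<in>V. M i j * f i * f j)" for f
  obtain i0 where i0: "i0 \<in> V" using ne by auto
  have "(\<Sum>i\<in>V. (if i = i0 then 1 else 0 :: real)\<^sup>2) = 1"
    using i0 fin by (simp add: if_distrib[of "\<lambda>x. x\<^sup>2"] cong: if_cong)
  then have "K \<noteq> {}"
    using i0 by (auto simp: K_def intro!: exI[of _ "\<lambda>i. if i = i0 then 1 else 0"] split: if_splits)
  moreover have "continuous_on K Q"
    unfolding Q_def
    by (intro continuous_intros continuous_on_subset[OF continuous_on_product_coordinates]) auto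
  ultimately obtain f where f: "f \<in> K" and fmax: "\<And>g. g \<in> K \<Longrightarrow> Q g \<le> Q f"
    using continuous_attains_sup[of K Q] compact_sphere_fun[OF fin] unfolding K_def by blast
  define s where "s = Q f"
  have bound: "Q g \<le> s * (\<Sum>i\<in>V. (g i)\<^sup>2)" for g
  proof (cases "(\<Sum>i\<in>V. (g i)\<^sup>2) = 0")
    case True
    then have "g i = 0" if "i \<in> V" for i
      using that fin by (simp add: sum_nonneg_eq_0_iff)
    then show ?thesis unfolding Q_def by simp
  next
    case False
    define N where "N = (\<Sum>i\<in>V. (g i)\<^sup>2)"
    have N: "N > 0" using False sum_nonneg[of V "\<lambda>i. (g i)\<^sup>2"] unfolding N_def by auto
    \<comment> \<open>Besides normalising, \<open>g'\<close> must vanish outside \<open>V\<close> to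
      lie in \<open>K\<close>; the form does not see those coordinates.\<close>
    define g' where "g' i = (if i \<in> V then g i / sqrt N else 0)" for i
    have "(\<Sum>i\<in>V. (g' i)\<^sup>2) = (\<Sum>i\<in>V. (g i)\<^sup>2 / N)"
      using N by (intro sum.cong refl) (simp add: g'_def power_divide)
    also have "\<dots> = 1"
      using N by (simp add: sum_divide_distrib[symmetric] N_def[symmetric])
    finally have "g' \<in> K" by (simp add: K_def g'_def)
    then have "Q g' \<le> s" using fmax s_def by simp
    moreover have "Q g' = (\<Sum>i\<in>V. \<Sum>j\<in>V. M i j * g i * g j / N)"
      unfolding Q_def using N
      by (intro sum.cong refl) (simp add: g'_def field_simps flip: power2_eq_square)
    then have "Q g' = Q g / N"
      by (simp add: Q_def sum_divide_distrib)
    ultimately show ?thesis using N by (simp add: N_def[symmetric] divide_le_eq)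
  qed
  \<comment> \<open>\<open>h\<close> is the defect in the eigenvector equation and \<open>L\<close>
    its squared norm, so the goal becomes \<open>L = 0\<close>.\<close>
  define h where "h i = (\<Sum>j\<in>V. M i j * f j) - s * f i" for i
  define L where "L = (\<Sum>i\<in>V. (h i)\<^sup>2)"
  define K' where "K' = Q h - s * L"
  have N1: "(\<Sum>i\<in>V. (f i)\<^sup>2) = 1" using f by (simp add: K_def)
  \<comment> \<open>First variation of \<open>Q g - s * |g|\<^sup>2\<close> at its maximiser \<open>f\<close>, in the direction of its gradient.\<close>
  have var: "2 * t * L + t\<^sup>2 * K' \<le> 0" for t
  proof -
    have "(\<Sum>i\<in>V. (f i + t * h i)\<^sup>2) =
        (\<Sum>i\<in>V. (f i)\<^sup>2 + 2 * t * (h i * f i) + t\<^sup>2 * (h i)\<^sup>2)"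
      by (intro sum.cong refl) (simp add: algebra_simps power2_eq_square)
    also have "\<dots> = 1 + 2 * t * (\<Sum>i\<in>V. h i * f i) + t\<^sup>2 * L"
      unfolding sum.distrib sum_distrib_left[symmetric] N1 L_def ..
    finally have n: "(\<Sum>i\<in>V. (f i + t * h i)\<^sup>2) = 1 + 2 * t * (\<Sum>i\<in>V. h i * f i) + t\<^sup>2 * L" .
    have "L = (\<Sum>i\<in>V. h i * (\<Sum>j\<in>V. M i j * f j) - s * (h i * f i))"
      unfolding L_def by (intro sum.cong refl) (simp add: h_def power2_eq_square algebra_simps)
    then have L: "L = (\<Sum>i\<in>V. h i * (\<Sum>j\<in>V. M i j * f j)) - s * (\<Sum>i\<in>V. h i * f i)"
      by (simp only: sum_subtractf sum_distrib_left)
    have "Q (\<lambda>i. f i + t * h i) \<le> s * (\<Sum>i\<in>V. (f i + t * h i)\<^sup>2)" by (rule bound)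
    then have "s + 2 * t * (\<Sum>i\<in>V. h i * (\<Sum>j\<in>V. M i j * f j)) + t\<^sup>2 * Q h
       \<le> s * (1 + 2 * t * (\<Sum>i\<in>V. h i * f i) + t\<^sup>2 * L)"
      unfolding n using symmetric_form_add[OF sym, where f = f and h = h and t = t] by (simp add: Q_def s_def)
    then show ?thesis by (simp add: L K'_def algebra_simps)
  qed
  have "L = 0"
  proof (rule ccontr)
    assume "L \<noteq> 0"
    then have L: "L > 0" using sum_nonneg[of V "\<lambda>i. (h i)\<^sup>2"] by (simp add: L_def)
    \<comment> \<open>A step so short that the quadratic term \<open>t\<^sup>2 * K'\<close> cannot
      cancel the positive linear term \<open>2 * t * L\<close>.\<close>
    define t where "t = L / (\<bar>K'\<bar> + 1)"
    have t: "t > 0" using L by (simp add: t_def)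
    have "t * \<bar>K'\<bar> < L" using L by (simp add: t_def field_simps)
    then have "- (t * K') < L" using t by (smt (verit) mult_left_mono minus_mult_right)
    then have "0 < t * (2 * L + t * K')" using t L by (intro mult_pos_pos) auto
    then show False using var[of t] by (simp add: power2_eq_square algebra_simps)
  qed
  then have "h i = 0" if "i \<in> V" for i
    using that fin by (simp add: L_def sum_nonneg_eq_0_iff)
  then have "(\<Sum>j\<in>V. M i j * f j) = s * f i" if "i \<in> V" for i
    using that by (simp add: h_def)
  moreover have "\<exists>i\<in>V. f i \<noteq> 0"
    using N1 by (metis (no_types, lifting) power_zero_numeral sum.neutral zero_neq_one)
  ultimately show thesis using that bound unfolding Q_def by blast
qed

text \<open>For a symmetric matrix the operator norm is controlled by the numerical radius:
  polarisation turns a bound on the form into one on the bilinear form, evaluated at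
  \<open>g\<close> and its image.\<close>

lemma symmetric_form_bound_norm:
  fixes M :: "'b \<Rightarrow> 'b \<Rightarrow> real"
  assumes sym: "\<And>i j. i \<in> V \<Longrightarrow> j \<in> V \<Longrightarrow> M i j = M j i"
    and c: "c > 0"
    and bound: "\<And>f. \<bar>\<Sum>i\<in>V. \<Sum>j\<in>V. M i j * f i * f j\<bar> \<le> c * (\<Sum>i\<in>V. (f i)\<^sup>2)"
  shows "(\<Sum>i\<in>V. (\<Sum>j\<in>V. M i j * g j)\<^sup>2) \<le> c\<^sup>2 * (\<Sum>i\<in>V. (g i)\<^sup>2)"
proof -
  define h where "h i = (\<Sum>j\<in>V. M i j * g j)" for i
  define H where "H = (\<Sum>i\<in>V. (h i)\<^sup>2)"
  define N where "N = (\<Sum>i\<in>V. (g i)\<^sup>2)"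
  define Q where "Q f = (\<Sum>i\<in>V. \<Sum>j\<in>V. M i j * f i * f j)" for f
  have HH: "(\<Sum>i\<in>V. h i * (\<Sum>j\<in>V. M i j * g j)) = H"
    unfolding H_def h_def by (simp add: power2_eq_square)
  have E: "Q (\<lambda>i. g i + t * h i) = Q g + 2 * t * H + t\<^sup>2 * Q h" for t
    using symmetric_form_add[OF sym, where f = g and h = h and t = t] by (simp add: Q_def HH)
  have S: "(\<Sum>i\<in>V. (g i + t * h i)\<^sup>2) = N + 2 * t * (\<Sum>i\<in>V. g i * h i) + t\<^sup>2 * H" for t
  proof -
    have "(\<Sum>i\<in>V. (g i + t * h i)\<^sup>2) = (\<Sum>i\<in>V. (g i)\<^sup>2 + 2 * t * (g i * h i) + t\<^sup>2 * (h i)\<^sup>2)"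
      by (intro sum.cong refl) (simp add: algebra_simps power2_eq_square)
    also have "\<dots> = N + 2 * t * (\<Sum>i\<in>V. g i * h i) + t\<^sup>2 * H"
      unfolding sum.distrib sum_distrib_left[symmetric] N_def H_def ..
    finally show ?thesis .
  qed
  \<comment> \<open>Polarisation of the form at \<open>g\<close> and \<open>h / c\<close>.\<close>
  have pol: "Q (\<lambda>i. g i + t * h i) - Q (\<lambda>i. g i + (- t) * h i) \<le>
      c * (\<Sum>i\<in>V. (g i + t * h i)\<^sup>2) + c * (\<Sum>i\<in>V. (g i + (- t) * h i)\<^sup>2)" for t
    using bound[of "\<lambda>i. g i + t * h i"] bound[of "\<lambda>i. g i + (- t) * h i"]
    unfolding Q_def by linarith
  have "4 * t * H \<le> 2 * c * (N + t\<^sup>2 * H)" for t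
    using pol[of t] unfolding E S by (simp add: algebra_simps)
  \<comment> \<open>With this \<open>t\<close> the inequality reads
    \<open>4 * H / c \<le> 2 * c * N + 2 * H / c\<close>, so half of the left side absorbs the
    \<open>H\<close> on the right.\<close>
  from this[of "1/c"] have "H \<le> c\<^sup>2 * N"
    using c by (simp add: field_simps power2_eq_square)
  then show ?thesis by (simp add: H_def N_def h_def)
qed

section \<open>Characteristic polynomials and eigenvalues of matrices with constant row sums\<close>

text \<open>Adding all columns to the first one turns it into a multiple of the all-ones column; the two
  matrices of the lemma then differ only by column operations involving that column.\<close>

lemma char_poly_deflate:
  fixes A :: "'b :: field mat"
  assumes A: "A \<in> carrier_mat n n" and n: "n > 0"
    and rows: "\<And>i. i < n \<Longrightarrow> (\<Sum>j<n. A $$ (i, j)) = d"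
    and c: "of_nat n * c = d"
  shows "[:0, 1:] * char_poly A = [:- d, 1:] * char_poly (mat n n (\<lambda>(i, j). A $$ (i, j) - c))"
proof -
  define X :: "'b poly" where "X = [:0, 1:]"
  define A' where "A' = mat n n (\<lambda>(i, j). A $$ (i, j) - c)"
  define C where "C = char_poly_matrix A"
  define C' where "C' = char_poly_matrix A'"
  have A': "A' \<in> carrier_mat n n" by (simp add: A'_def)
  have C: "C \<in> carrier_mat n n" and C': "C' \<in> carrier_mat n n"
    using A A' by (simp_all add: C_def C'_def)
  have Cij: "C $$ (i, j) = (if i = j then X else 0) + [:- A $$ (i, j):]" if "i < n" "j < n" for i j
    using that A by (simp add: C_def X_def char_poly_matrix_def)
  have C'ij: "C' $$ (i, j) = C $$ (i, j) + [:c:]" if "i < n" "j < n" for i j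
    unfolding Cij[OF that] using that by (simp add: C'_def X_def char_poly_matrix_def A'_def)
  have rowC: "(\<Sum>k<n. C $$ (i, k)) = [:- d, 1:]" if i: "i < n" for i
  proof -
    have "(\<Sum>k<n. C $$ (i, k)) = (\<Sum>k<n. (if i = k then X else 0) + [:- A $$ (i, k):])"
      using i by (intro sum.cong) (auto simp: Cij)
    also have "\<dots> = X + [:- d:]"
      using i rows[OF i] by (simp add: sum.distrib sum_to_poly sum_negf)
    finally show ?thesis by (simp add: X_def)
  qed
  have rowC': "(\<Sum>k<n. C' $$ (i, k)) = X" if i: "i < n" for i
  proof -
    have "(\<Sum>k<n. C' $$ (i, k)) = (\<Sum>k<n. C $$ (i, k) + [:c:])"
      using i by (intro sum.cong) (auto simp: C'ij)
    also have "\<dots> = [:- d, 1:] + [:of_nat n * c:]"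
      by (simp add: sum.distrib rowC[OF i] sum_to_poly of_nat_poly)
    finally show ?thesis by (simp add: c X_def)
  qed
  \<comment> \<open>\<open>P\<close> adds all columns to the first. Both products then share the
    factor \<open>B\<close>, whose first column is all ones: \<open>D\<close> scales that column by
    the row sum of \<open>C\<close>, while \<open>R\<close> scales it by the row sum of
    \<open>C'\<close> and adds \<open>c\<close> times it to every other column. \<open>P\<close>,
    \<open>D\<close> and \<open>R\<close> are triangular, so their determinants can be read
    off.\<close>
  define P :: "'b poly mat" where "P = mat n n (\<lambda>(i, j). if j = 0 \<or> i = j then 1 else 0)"
  define B where "B = mat n n (\<lambda>(i, j). if j = 0 then 1 else C $$ (i, j))"
  define D :: "'b poly mat" where
    "D = mat n n (\<lambda>(i, j). if i = j then if i = 0 then [:- d, 1:] else 1 else 0)"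
  define R :: "'b poly mat" where
    "R = mat n n (\<lambda>(i, j). if i = 0 then if j = 0 then X else [:c:] else if i = j then 1 else 0)"
  have cm: "P \<in> carrier_mat n n" "B \<in> carrier_mat n n" "D \<in> carrier_mat n n" "R \<in> carrier_mat n n"
    by (simp_all add: P_def B_def D_def R_def)
  have mult: "(Y * Z) $$ (i, j) = (\<Sum>k<n. Y $$ (i, k) * Z $$ (k, j))"
    if "Y \<in> carrier_mat n n" "Z \<in> carrier_mat n n" "i < n" "j < n" for Y Z :: "'b poly mat" and i j
    using that by (simp add: scalar_prod_def lessThan_atLeast0)
  have YP: "(Y * P) $$ (i, j) = (if j = 0 then \<Sum>k<n. Y $$ (i, k) else Y $$ (i, j))"
    if Y: "Y \<in> carrier_mat n n" and ij: "i < n" "j < n" for Y i j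
  proof -
    have "(Y * P) $$ (i, j) = (\<Sum>k<n. if j = 0 then Y $$ (i, k) else if k = j then Y $$ (i, k) else 0)"
      unfolding mult[OF Y cm(1) ij] using ij by (intro sum.cong) (auto simp: P_def)
    then show ?thesis using ij by simp
  qed
  have "C * P = B * D"
  proof (rule eq_matI)
    fix i j assume "i < dim_row (B * D)" "j < dim_col (B * D)"
    then have ij: "i < n" "j < n" using cm by auto
    have "(B * D) $$ (i, j) = (\<Sum>k<n. if k = j then B $$ (i, k) * D $$ (k, k) else 0)"
      unfolding mult[OF cm(2,3) ij] using ij by (intro sum.cong) (auto simp: D_def)
    then show "(C * P) $$ (i, j) = (B * D) $$ (i, j)"
      using ij by (simp add: YP[OF C] rowC B_def D_def)
  qed (use C cm in auto)
  moreover have "C' * P = B * R"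
  proof (rule eq_matI)
    fix i j assume "i < dim_row (B * R)" "j < dim_col (B * R)"
    then have ij: "i < n" "j < n" using cm by auto
    \<comment> \<open>For \<open>j = 0\<close> the indices \<open>0\<close> and \<open>j\<close>
      coincide; the inner \<open>if\<close> keeps that entry from being counted twice.\<close>
    have "(B * R) $$ (i, j) = (\<Sum>k<n. (if k = 0 then R $$ (0, j) else 0)
        + (if k = j then if j = 0 then 0 else C $$ (i, j) else 0))"
      unfolding mult[OF cm(2,4) ij] using ij by (intro sum.cong) (auto simp: R_def B_def)
    then show "(C' * P) $$ (i, j) = (B * R) $$ (i, j)"
      unfolding YP[OF C' ij] rowC'[OF ij(1)] C'ij[OF ij] using ij n by (simp add: sum.distrib R_def)
  qed (use C' cm in auto)
  moreover have "det P = 1"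
    by (subst det_lower_triangular[OF _ cm(1)]) (auto simp: P_def prod_list_diag_prod)
  moreover have "det D = [:- d, 1:]"
  proof -
    have "det D = (\<Prod>k\<in>{0..<n}. if k = 0 then [:- d, 1:] else 1)"
      by (subst det_lower_triangular[OF _ cm(3)]) (auto simp: D_def prod_list_diag_prod intro!: prod.cong)
    then show ?thesis using n by simp
  qed
  moreover have "det R = X"
  proof -
    have "upper_triangular R" by (auto simp: R_def upper_triangular_def)
    then have "det R = (\<Prod>k\<in>{0..<n}. R $$ (k, k))"
      using det_upper_triangular[OF _ cm(4)] cm(4) by (simp add: prod_list_diag_prod)
    also have "\<dots> = (\<Prod>k\<in>{0..<n}. if k = 0 then X else 1)"
      by (intro prod.cong) (auto simp: R_def)
    finally show ?thesis using n by simp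
  qed
  ultimately have "det C = det B * [:- d, 1:]" "det C' = det B * X"
    using det_mult[OF C cm(1)] det_mult[OF C' cm(1)] det_mult[OF cm(2,3)] det_mult[OF cm(2,4)]
    by simp_all
  then show ?thesis
    by (simp add: char_poly_def C_def C'_def A'_def X_def mult_ac)
qed

lemma eigenvalue_iff_fun:
  fixes A :: "'b :: comm_ring_1 mat"
  assumes A: "A \<in> carrier_mat n n"
  shows "eigenvalue A s \<longleftrightarrow>
    (\<exists>f. (\<exists>i<n. f i \<noteq> 0) \<and> (\<forall>i<n. (\<Sum>j<n. A $$ (i, j) * f j) = s * f i))"
proof
  assume "eigenvalue A s"
  then obtain v where v: "v \<in> carrier_vec n" "v \<noteq> 0\<^sub>v n" "A *\<^sub>v v = s \<cdot>\<^sub>v v"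
    using A by (auto simp: eigenvalue_def eigenvector_def)
  have "\<exists>i<n. v $ i \<noteq> 0" using v(1,2) by (metis carrier_vecD eq_vecI index_zero_vec)
  moreover have "(\<Sum>j<n. A $$ (i, j) * v $ j) = s * v $ i" if "i < n" for i
  proof -
    have "(A *\<^sub>v v) $ i = (\<Sum>j<n. A $$ (i, j) * v $ j)"
      using A v(1) that by (simp add: scalar_prod_def lessThan_atLeast0)
    then show ?thesis using v that by simp
  qed
  ultimately show "\<exists>f. (\<exists>i<n. f i \<noteq> 0) \<and> (\<forall>i<n. (\<Sum>j<n. A $$ (i, j) * f j) = s * f i)"
    by (intro exI[of _ "\<lambda>i. v $ i"]) blast
next
  assume "\<exists>f. (\<exists>i<n. f i \<noteq> 0) \<and> (\<forall>i<n. (\<Sum>j<n. A $$ (i, j) * f j) = s * f i)"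
  then obtain f where f: "\<exists>i<n. f i \<noteq> 0" "\<forall>i<n. (\<Sum>j<n. A $$ (i, j) * f j) = s * f i"
    by blast
  have "vec n f \<noteq> 0\<^sub>v n" using f(1) by (metis index_vec index_zero_vec(1))
  moreover have "A *\<^sub>v vec n f = s \<cdot>\<^sub>v vec n f"
    using A f(2) by (intro eq_vecI) (auto simp: scalar_prod_def lessThan_atLeast0)
  ultimately show "eigenvalue A s"
    using A by (auto simp: eigenvalue_def eigenvector_def intro!: exI[of _ "vec n f"])
qed

text \<open>Weight \<open>2 * f i * f j \<le> (f i)\<^sup>2 + (f j)\<^sup>2\<close> by
  \<open>M i j\<close> and sum; by symmetry rows and columns both sum to \<open>d\<close>. This
  identifies the degree as the largest adjacency eigenvalue.\<close>

lemma eigenvalue_le_row_sum: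
  fixes M :: "'b \<Rightarrow> 'b \<Rightarrow> real"
  assumes fin: "finite V"
    and sym: "\<And>i j. i \<in> V \<Longrightarrow> j \<in> V \<Longrightarrow> M i j = M j i"
    and nonneg: "\<And>i j. i \<in> V \<Longrightarrow> j \<in> V \<Longrightarrow> M i j \<ge> 0"
    and rows: "\<And>i. i \<in> V \<Longrightarrow> (\<Sum>j\<in>V. M i j) = d"
    and f: "i0 \<in> V" "f i0 \<noteq> 0" "\<And>i. i \<in> V \<Longrightarrow> (\<Sum>j\<in>V. M i j * f j) = s * f i"
  shows "s \<le> d"
proof -
  define N where "N = (\<Sum>i\<in>V. (f i)\<^sup>2)"
  have "N > 0" unfolding N_def using f fin by (intro sum_pos2[of V i0]) auto
  have "(\<Sum>i\<in>V. \<Sum>j\<in>V. M i j * (f j)\<^sup>2) = (\<Sum>j\<in>V. \<Sum>i\<in>V. M i j * (f j)\<^sup>2)"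
    by (rule sum.swap)
  also have "\<dots> = (\<Sum>i\<in>V. \<Sum>j\<in>V. M i j * (f i)\<^sup>2)"
    using sym by (intro sum.cong refl) auto
  also have "\<dots> = d * N"
    using rows by (simp add: sum_distrib_right[symmetric] N_def sum_distrib_left)
  finally have col: "(\<Sum>i\<in>V. \<Sum>j\<in>V. M i j * (f j)\<^sup>2) = d * N" .
  have row: "(\<Sum>i\<in>V. \<Sum>j\<in>V. M i j * (f i)\<^sup>2) = d * N"
    using rows by (simp add: sum_distrib_right[symmetric] N_def sum_distrib_left)
  have "s * N = (\<Sum>i\<in>V. f i * (\<Sum>j\<in>V. M i j * f j))"
    using f(3) by (simp add: N_def sum_distrib_left power2_eq_square mult_ac)
  then have "2 * (s * N) = (\<Sum>i\<in>V. \<Sum>j\<in>V. M i j * (2 * f i * f j))"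
    by (simp add: sum_distrib_left mult_ac)
  also have "\<dots> \<le> (\<Sum>i\<in>V. \<Sum>j\<in>V. M i j * ((f i)\<^sup>2 + (f j)\<^sup>2))"
    using nonneg by (intro sum_mono mult_left_mono sum_squares_bound) auto
  also have "\<dots> = 2 * (d * N)"
    by (simp only: distrib_left sum.distrib row col)
  finally show ?thesis using \<open>N > 0\<close> by simp
qed

section \<open>The spectral bound for \<open>ndl_graph\<close>\<close>

lemma ndl_graph_degree:
  assumes "ndl_graph n d l G" "v \<in> pverts G"
  shows "card {u \<in> pverts G. (v, u) \<in> parcs G} = d"
proof -
  interpret pair_graph G using assms(1) by (simp add: ndl_graph_def)
  have "d = card (out_arcs (with_proj G) v)"
    using assms by (auto simp: ndl_graph_def out_degree_def)
  also have "out_arcs (with_proj G) v = Pair v ` {u \<in> pverts G. (v, u) \<in> parcs G}"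
    using in_arcsD2 by (auto simp: out_arcs_def)
  also have "card \<dots> = card {u \<in> pverts G. (v, u) \<in> parcs G}"
    by (intro card_image inj_onI) auto
  finally show ?thesis by simp
qed

text \<open>Subtracting \<open>d / n\<close> from every entry replaces one copy of the top
  eigenvalue \<open>d\<close> by 0 and keeps the others, which are at most \<open>l\<close> in
  absolute value by hypothesis. The extreme values of the form are eigenvalues, so they obey the
  same bound.\<close>

lemma ndl_graph_form_bound:
  fixes G :: "'a pair_pre_digraph"
  assumes ndl: "ndl_graph n d l G" and d: "d > 0" and n: "n > 0"
  shows "l > 0"
    and "\<bar>\<Sum>u\<in>pverts G. \<Sum>v\<in>pverts G. (of_bool ((u, v) \<in> parcs G) - real d / real n) * f u * f v\<bar>
      \<le> l * (\<Sum>u\<in>pverts G. (f u)\<^sup>2)"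
proof -
  interpret pair_graph G using ndl by (simp add: ndl_graph_def)
  \<comment> \<open>The same choice term as in \<open>adjacency_eigenvalues\<close>, so no
    independence of the enumeration has to be proved.\<close>
  define vs where "vs = (SOME vs. distinct vs \<and> set vs = pverts G)"
  have "\<exists>vs. distinct vs \<and> set vs = pverts G"
    using finite_distinct_list[OF pair_finite_verts] by blast
  then have vs: "distinct vs" "set vs = pverts G"
    unfolding vs_def by (metis (mono_tags, lifting) someI_ex)+
  have len: "length vs = n"
    using vs ndl by (metis distinct_card ndl_graph_def)
  have bij: "bij_betw (\<lambda>i. vs ! i) {..<n} (pverts G)"
    using bij_betw_nth[OF vs(1)] len vs(2) by simp
  define A where "A = adjacency_mat G vs"
  have A: "A \<in> carrier_mat n n" by (simp add: A_def adjacency_mat_def len)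
  have Aij: "A $$ (i, j) = of_bool ((vs ! i, vs ! j) \<in> parcs G)" if "i < n" "j < n" for i j
    using that by (simp add: A_def adjacency_mat_def len)
  have Asym: "A $$ (i, j) = A $$ (j, i)" if "i < n" "j < n" for i j
    using that arcs_symmetric by (auto simp: Aij)
  have rows: "(\<Sum>j<n. A $$ (i, j)) = real d" if i: "i < n" for i
  proof -
    have "(\<Sum>j<n. A $$ (i, j)) = (\<Sum>j<n. of_bool ((vs ! i, vs ! j) \<in> parcs G))"
      using i by (intro sum.cong) (auto simp: Aij)
    also have "\<dots> = (\<Sum>v\<in>pverts G. of_bool ((vs ! i, v) \<in> parcs G))"
      by (rule sum.reindex_bij_betw[OF bij])
    also have "\<dots> = real (card {u \<in> pverts G. (vs ! i, u) \<in> parcs G})"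
      using pair_finite_verts by (simp add: of_bool_def sum.If_cases Int_def)
    also have "\<dots> = real d"
      using ndl_graph_degree[OF ndl] i vs len nth_mem by metis
    finally show ?thesis .
  qed
  define A' where "A' = mat n n (\<lambda>(i, j). A $$ (i, j) - real d / real n)"
  have A': "A' \<in> carrier_mat n n" by (simp add: A'_def)
  have nz: "char_poly A \<noteq> 0" "char_poly A' \<noteq> 0"
    using degree_monic_char_poly[OF A] degree_monic_char_poly[OF A'] by auto
  \<comment> \<open>Comparing roots with multiplicity, the spectrum of \<open>A\<close> with an
    extra 0 equals that of \<open>A'\<close> with an extra \<open>d\<close>.\<close>
  have "[:0, 1:] * char_poly A = [:- real d, 1:] * char_poly A'"
    unfolding A'_def using n by (intro char_poly_deflate[OF A n rows]) auto
  moreover have "proots ([:0, 1:] * char_poly A) = proots [:0, 1:] + proots (char_poly A)"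
    "proots ([:- real d, 1:] * char_poly A') = proots [:- real d, 1:] + proots (char_poly A')"
    using nz by (intro proots_mult; simp)+
  ultimately have proots: "proots (char_poly A) + {#0#} = proots (char_poly A') + {#real d#}"
    by simp
  \<comment> \<open>Positivity of \<open>d\<close> ensures that the copy of \<open>d\<close> found
    here is not the added 0.\<close>
  have "real d \<in># proots (char_poly A)"
  proof -
    have "real d \<in># proots (char_poly A) + {#0#}" unfolding proots by simp
    then show ?thesis using d by (simp only: union_iff) simp
  qed
  \<comment> \<open>Makes \<open>d\<close> the maximum, so the single eigenvalue exempted in
    \<open>ndl_graph\<close> is exactly the one removed by deflation.\<close>
  moreover have "\<mu> \<le> real d" if "\<mu> \<in># proots (char_poly A)" for \<mu>
  proof -
    have "eigenvalue A \<mu>" using that nz eigenvalue_root_char_poly[OF A] by simp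
    then obtain g i where g: "i < n" "g i \<noteq> 0" "\<forall>i<n. (\<Sum>j<n. A $$ (i, j) * g j) = \<mu> * g i"
      unfolding eigenvalue_iff_fun[OF A] by blast
    show ?thesis
      using g rows Asym Aij
      by (intro eigenvalue_le_row_sum[of "{..<n}" "\<lambda>i j. A $$ (i, j)" "real d" i g \<mu>]) auto
  qed
  ultimately have "Max_mset (proots (char_poly A)) = real d"
    by (intro Max_eqI) auto
  moreover have "adjacency_eigenvalues G = proots (char_poly A)"
    by (simp add: adjacency_eigenvalues_def A_def vs_def)
  ultimately have ev: "\<bar>\<mu>\<bar> \<le> l" if "\<mu> \<in># proots (char_poly A) - {#real d#}" for \<mu>
    using ndl that by (simp add: ndl_graph_def)
  have "proots (char_poly A) - {#real d#} + {#0#} = proots (char_poly A')"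
    using proots \<open>real d \<in># proots (char_poly A)\<close>
    by (metis add.commute add_diff_cancel_right' multiset_diff_union_assoc single_subset_iff
        union_commute subset_mset.diff_add_assoc2)
  \<comment> \<open>The case \<open>s = 0\<close> stays separate because the sign of
    \<open>l\<close> is not yet known.\<close>
  then have evA': "s = 0 \<or> \<bar>s\<bar> \<le> l" if "eigenvalue A' s" for s
  proof -
    have "s \<in># proots (char_poly A) - {#real d#} + {#0#}"
      unfolding \<open>_ = proots (char_poly A')\<close>
      using that nz eigenvalue_root_char_poly[OF A'] by simp
    then show ?thesis using ev by (auto simp only: union_iff) auto
  qed
  define M where "M i j = A' $$ (i, j)" for i j
  have M: "M i j = A $$ (i, j) - real d / real n" if "i < n" "j < n" for i j
    using that by (simp add: M_def A'_def)
  have Msym: "M i j = M j i" if "i \<in> {..<n}" "j \<in> {..<n}" for i j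
    using that by (simp add: M Asym)
  define Q where "Q g = (\<Sum>i<n. \<Sum>j<n. M i j * g i * g j)" for g
  have ne: "{..<n} \<noteq> {}" using n by auto
  obtain s1 g1 where 1: "\<exists>i\<in>{..<n}. g1 i \<noteq> 0" "\<And>i. i \<in> {..<n} \<Longrightarrow> (\<Sum>j<n. M i j * g1 j) = s1 * g1 i"
    "\<And>g. Q g \<le> s1 * (\<Sum>i<n. (g i)\<^sup>2)"
    by (rule symmetric_form_max_eigenvector[OF finite_lessThan ne, of M])
      (simp add: Msym, rule that, simp_all add: Q_def)
  \<comment> \<open>The top eigenvalue of the negated matrix yields the lower bound on the
    form.\<close>
  obtain s2 g2 where 2: "\<exists>i\<in>{..<n}. g2 i \<noteq> 0" "\<And>i. i \<in> {..<n} \<Longrightarrow> (\<Sum>j<n. - M i j * g2 j) = s2 * g2 i"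
    "\<And>g. (\<Sum>i<n. \<Sum>j<n. - M i j * g i * g j) \<le> s2 * (\<Sum>i<n. (g i)\<^sup>2)"
    by (rule symmetric_form_max_eigenvector[OF finite_lessThan ne, of "\<lambda>i j. - M i j"])
      (simp add: Msym, rule that)
  have "eigenvalue A' s1"
    unfolding eigenvalue_iff_fun[OF A'] using 1(1,2) by (auto simp: M_def intro!: exI[of _ g1])
  moreover have "eigenvalue A' (- s2)"
    unfolding eigenvalue_iff_fun[OF A'] using 2(1,2)
    by (auto simp: M_def sum_negf neg_equal_iff_equal minus_equation_iff intro!: exI[of _ g2])
  ultimately have s: "s1 = 0 \<or> \<bar>s1\<bar> \<le> l" "s2 = 0 \<or> \<bar>s2\<bar> \<le> l"
    using evA' by (force, force)
  have Q2: "- Q g \<le> s2 * (\<Sum>i<n. (g i)\<^sup>2)" for g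
    using 2(3)[of g] by (simp add: Q_def sum_negf)
  \<comment> \<open>The deflated matrix has diagonal entries \<open>- d / n\<close>, so its form does not vanish.\<close>
  have "s2 > 0"
  proof -
    define g :: "nat \<Rightarrow> real" where "g i = (if i = 0 then 1 else 0)" for i
    have "Q g = (\<Sum>i<n. \<Sum>j<n. if j = 0 then if i = 0 then M 0 0 else 0 else 0)"
      unfolding Q_def g_def by (intro sum.cong refl) auto
    then have "Q g = M 0 0" using n by simp
    also have "\<dots> = - (real d / real n)"
      using n pair_no_loops[of "(vs ! 0, vs ! 0)"] by (auto simp: M Aij)
    finally have "real d / real n \<le> s2 * (\<Sum>i<n. (g i)\<^sup>2)" using Q2[of g] by simp
    also have "(\<Sum>i<n. (g i)\<^sup>2) = 1"
      using n by (simp add: g_def if_distrib[of "\<lambda>x. x\<^sup>2"] cong: if_cong)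
    finally show ?thesis using d n by (smt (verit) divide_pos_pos of_nat_0_less_iff)
  qed
  \<comment> \<open>Since \<open>s2\<close> is nonzero, only the alternative
    \<open>\<bar>s2\<bar> \<le> l\<close> remains.\<close>
  then show l: "l > 0" using s by auto
  have "\<bar>Q g\<bar> \<le> l * (\<Sum>i<n. (g i)\<^sup>2)" for g
  proof -
    have "s1 * (\<Sum>i<n. (g i)\<^sup>2) \<le> l * (\<Sum>i<n. (g i)\<^sup>2)" "s2 * (\<Sum>i<n. (g i)\<^sup>2) \<le> l * (\<Sum>i<n. (g i)\<^sup>2)"
      using s l by (auto intro!: mult_right_mono sum_nonneg)
    then show ?thesis using 1(3)[of g] Q2[of g] by linarith
  qed
  from this[of "\<lambda>i. f (vs ! i)"]
  have "\<bar>\<Sum>i<n. \<Sum>j<n. (of_bool ((vs ! i, vs ! j) \<in> parcs G) - real d / real n) * f (vs ! i) * f (vs ! j)\<bar>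
    \<le> l * (\<Sum>i<n. (f (vs ! i))\<^sup>2)"
    by (simp add: Q_def M Aij)
  then show "\<bar>\<Sum>u\<in>pverts G. \<Sum>v\<in>pverts G. (of_bool ((u, v) \<in> parcs G) - real d / real n) * f u * f v\<bar>
      \<le> l * (\<Sum>u\<in>pverts G. (f u)\<^sup>2)"
    by (simp add: sum.reindex_bij_betw[OF bij, symmetric])
qed

section \<open>Counting \<open>H3_minus\<close> by walks inside neighbourhoods\<close>

text \<open>Once the hub \<open>x\<close> and the middle vertex \<open>z\<close> are fixed, the arms
  \<open>(y, x')\<close> and \<open>(u, v)\<close> are independent walks of length two from
  \<open>z\<close> inside \<open>S x\<close>; hence the square.\<close>

lemma H3_minus_eq_sum:
  assumes "pair_graph G" "finite W"
  defines "S \<equiv> \<lambda>x. {y \<in> W. (x, y) \<in> parcs G}"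
  shows "real (H3_minus G W) = (\<Sum>x\<in>W. \<Sum>z\<in>S x.
    (\<Sum>y\<in>S x. of_bool ((z, y) \<in> parcs G) * (\<Sum>x'\<in>S x. of_bool ((y, x') \<in> parcs G)))\<^sup>2)"
proof -
  interpret pair_graph G by fact
  have fin: "finite (S x)" for x using assms(2) by (simp add: S_def)
  define T where "T x z = (SIGMA y:{y \<in> S x. (z, y) \<in> parcs G}. {x' \<in> S x. (y, x') \<in> parcs G})" for x z
  have finT: "finite (T x z)" for x z using fin by (auto simp: T_def)
  have cardT: "real (card (T x z)) =
    (\<Sum>y\<in>S x. of_bool ((z, y) \<in> parcs G) * (\<Sum>x'\<in>S x. of_bool ((y, x') \<in> parcs G)))" for x z
  proof -
    have "real (card (T x z)) = (\<Sum>y\<in>{y \<in> S x. (z, y) \<in> parcs G}. real (card {x' \<in> S x. (y, x') \<in> parcs G}))"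
      unfolding T_def using fin by (subst card_SigmaI) auto
    also have "\<dots> = (\<Sum>y\<in>S x. if (z, y) \<in> parcs G then real (card {x' \<in> S x. (y, x') \<in> parcs G}) else 0)"
      using fin by (simp add: sum.inter_filter)
    also have "\<dots> = (\<Sum>y\<in>S x. of_bool ((z, y) \<in> parcs G) * (\<Sum>x'\<in>S x. of_bool ((y, x') \<in> parcs G)))"
      using fin by (intro sum.cong refl) (simp add: of_bool_def sum.If_cases Int_def)
    finally show ?thesis .
  qed
  have "bij_betw (\<lambda>(x, z, (y, x'), (u, v)). (x, y, z, u, v, x'))
     (SIGMA x:W. SIGMA z:S x. T x z \<times> T x z) {(x, y, z, u, v, x').
     x \<in> W \<and> y \<in> W \<and> z \<in> W \<and> u \<in> W \<and> v \<in> W \<and> x' \<in> W \<and>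
     x \<rightarrow>\<^bsub>G\<^esub> y \<and> y \<rightarrow>\<^bsub>G\<^esub> z \<and> z \<rightarrow>\<^bsub>G\<^esub> u \<and> u \<rightarrow>\<^bsub>G\<^esub> x \<and>
     x \<rightarrow>\<^bsub>G\<^esub> x' \<and> x' \<rightarrow>\<^bsub>G\<^esub> y \<and> x \<rightarrow>\<^bsub>G\<^esub> v \<and> v \<rightarrow>\<^bsub>G\<^esub> u \<and> x \<rightarrow>\<^bsub>G\<^esub> z}"
    by (rule bij_betw_byWitness[where f' = "\<lambda>(x, y, z, u, v, x'). (x, z, (y, x'), (u, v))"])
      (auto simp: T_def S_def intro: arcs_symmetric)
  then have "H3_minus G W = card (SIGMA x:W. SIGMA z:S x. T x z \<times> T x z)"
    unfolding H3_minus_def by (rule bij_betw_same_card[symmetric])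
  also have "\<dots> = (\<Sum>x\<in>W. \<Sum>z\<in>S x. (card (T x z))\<^sup>2)"
    using assms(2) fin finT
    by (simp add: card_SigmaI card_cartesian_product power2_eq_square)
  finally show ?thesis by (simp add: cardT)
qed

text \<open>By Cauchy-Schwarz the constant matrix \<open>d / n\<close> contributes at most
  \<open>d * card S / n\<close> to the form on \<open>S\<close>, and the deflated matrix at most
  \<open>l\<close>. The form bound then becomes a norm bound.\<close>

lemma ndl_graph_norm_bound:
  assumes ndl: "ndl_graph n d l G" and "d > 0" "n > 0" and S: "S \<subseteq> pverts G"
  shows "(\<Sum>u\<in>S. (\<Sum>v\<in>S. of_bool ((u, v) \<in> parcs G) * g v)\<^sup>2)
    \<le> (real d * real (card S) / real n + l)\<^sup>2 * (\<Sum>u\<in>S. (g u)\<^sup>2)"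
proof (rule symmetric_form_bound_norm)
  interpret pair_graph G using ndl by (simp add: ndl_graph_def)
  note form = ndl_graph_form_bound[OF ndl assms(2,3)]
  show "of_bool ((u, v) \<in> parcs G) = (of_bool ((v, u) \<in> parcs G) :: real)" for u v
    using arcs_symmetric by auto
  show "0 < real d * real (card S) / real n + l"
    using form(1) by (simp add: add_nonneg_pos)
  fix f :: "'a \<Rightarrow> real"
  \<comment> \<open>Extension by zero turns the form on \<open>S\<close> into a value of the form on
    all vertices.\<close>
  define f' where "f' u = (if u \<in> S then f u else 0)" for u
  define N where "N = (\<Sum>u\<in>S. (f u)\<^sup>2)"
  define a :: "'a \<Rightarrow> 'a \<Rightarrow> real" where "a u v = of_bool ((u, v) \<in> parcs G)" for u v
  have fin: "finite (pverts G)" by (rule pair_finite_verts)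
  have "(\<Sum>u\<in>pverts G. \<Sum>v\<in>pverts G. (a u v - real d / real n) * f' u * f' v) =
     (\<Sum>u\<in>S. \<Sum>v\<in>S. (a u v - real d / real n) * f u * f v)"
    using S fin by (intro sum.mono_neutral_cong_right) (auto simp: f'_def intro!: sum.mono_neutral_cong_right)
  also have "\<dots> = (\<Sum>u\<in>S. \<Sum>v\<in>S. a u v * f u * f v) - real d / real n * (\<Sum>u\<in>S. f u)\<^sup>2"
    by (simp add: power2_eq_square sum_product sum_subtractf sum_distrib_left algebra_simps)
  finally have 1: "(\<Sum>u\<in>pverts G. \<Sum>v\<in>pverts G. (a u v - real d / real n) * f' u * f' v) =
    (\<Sum>u\<in>S. \<Sum>v\<in>S. a u v * f u * f v) - real d / real n * (\<Sum>u\<in>S. f u)\<^sup>2" .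
  have 2: "(\<Sum>u\<in>pverts G. (f' u)\<^sup>2) = N"
    unfolding N_def using S fin by (intro sum.mono_neutral_cong_right) (auto simp: f'_def)
  have "\<bar>(\<Sum>u\<in>S. \<Sum>v\<in>S. a u v * f u * f v) - real d / real n * (\<Sum>u\<in>S. f u)\<^sup>2\<bar> \<le> l * N"
    using form(2)[of f'] 1 2 by (simp add: a_def)
  moreover have "(\<Sum>u\<in>S. f u)\<^sup>2 \<le> N * real (card S)"
    using sum_squared_le_sum_of_squares[of f S] by (simp add: N_def)
  then have "real d / real n * (\<Sum>u\<in>S. f u)\<^sup>2 \<le> real d / real n * (N * real (card S))"
    by (intro mult_left_mono) auto
  moreover have "real d / real n * (\<Sum>u\<in>S. f u)\<^sup>2 \<ge> 0" by simp
  ultimately have "\<bar>\<Sum>u\<in>S. \<Sum>v\<in>S. a u v * f u * f v\<bar> \<le> real d / real n * (N * real (card S)) + l * N"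
    by (smt (verit, best))
  also have "\<dots> = (real d * real (card S) / real n + l) * N"
    by (simp add: algebra_simps)
  finally show "\<bar>\<Sum>u\<in>S. \<Sum>v\<in>S. of_bool ((u, v) \<in> parcs G) * f u * f v\<bar>
    \<le> (real d * real (card S) / real n + l) * (\<Sum>u\<in>S. (f u)\<^sup>2)"
    by (simp add: a_def N_def)
qed

text \<open>For each hub the norm bound is applied twice, the second time to the constant function
  1, whose squared norm on the neighbourhood is at most \<open>D\<close>.\<close>

lemma H3_minus_le_max_degree:
  assumes ndl: "ndl_graph n d l G" and d: "d > 0" and n: "n > 0" and W: "W \<subseteq> pverts G"
    and deg: "\<And>x. x \<in> W \<Longrightarrow> real (card {y \<in> W. (x, y) \<in> parcs G}) \<le> D"
  shows "real (H3_minus G W) \<le> real (card W) * (D * (real d * D / real n + l) ^ 4)"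
proof -
  interpret pair_graph G using ndl by (simp add: ndl_graph_def)
  have finW: "finite W" using W pair_finite_verts by (rule finite_subset)
  have l: "l > 0" using ndl_graph_form_bound(1)[OF ndl d n] .
  define a :: "'a \<Rightarrow> 'a \<Rightarrow> real" where "a u v = of_bool ((u, v) \<in> parcs G)" for u v
  define S where "S x = {y \<in> W. (x, y) \<in> parcs G}" for x
  have "(\<Sum>z\<in>S x. (\<Sum>y\<in>S x. a z y * (\<Sum>x'\<in>S x. a y x'))\<^sup>2) \<le> D * (real d * D / real n + l) ^ 4"
    if x: "x \<in> W" for x
  proof -
    define c where "c = real d * real (card (S x)) / real n + l"
    have SV: "S x \<subseteq> pverts G" using W by (auto simp: S_def)
    have D: "real (card (S x)) \<le> D" using deg[OF x] by (simp add: S_def)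
    have c: "0 \<le> c" "c \<le> real d * D / real n + l"
      unfolding c_def using l D by (auto intro!: divide_right_mono mult_left_mono)
    \<comment> \<open>The factor \<open>* 1\<close> exhibits the inner sum as the matrix applied to
      the constant function, ready for the second application.\<close>
    have "(\<Sum>z\<in>S x. (\<Sum>y\<in>S x. a z y * (\<Sum>x'\<in>S x. a y x'))\<^sup>2) \<le> c\<^sup>2 * (\<Sum>y\<in>S x. (\<Sum>x'\<in>S x. a y x' * 1)\<^sup>2)"
      using ndl_graph_norm_bound[OF ndl d n SV, of "\<lambda>y. \<Sum>x'\<in>S x. a y x'"] by (simp add: a_def c_def)
    also have "\<dots> \<le> c\<^sup>2 * (c\<^sup>2 * (\<Sum>y\<in>S x. 1\<^sup>2))"
      using ndl_graph_norm_bound[OF ndl d n SV, of "\<lambda>_. 1"] unfolding a_def c_def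
      by (intro mult_left_mono) auto
    also have "\<dots> = real (card (S x)) * c ^ 4"
      by (simp add: power2_eq_square power4_eq_xxxx mult_ac)
    also have "\<dots> \<le> D * (real d * D / real n + l) ^ 4"
      using c D by (intro mult_mono power_mono) auto
    finally show ?thesis .
  qed
  then have "(\<Sum>x\<in>W. \<Sum>z\<in>S x. (\<Sum>y\<in>S x. a z y * (\<Sum>x'\<in>S x. a y x'))\<^sup>2)
      \<le> (\<Sum>x\<in>W. D * (real d * D / real n + l) ^ 4)"
    by (rule sum_mono)
  then show ?thesis
    using H3_minus_eq_sum[OF pair_graph_axioms finW] by (simp add: a_def S_def)
qed

section \<open>Deleting vertices of large degree and the final estimate\<close>

text \<open>A Chebyshev argument: the deflated matrix sends the indicator of \<open>U\<close> to the
  deviations of the degrees into \<open>U\<close> from \<open>d * m / n\<close>, and the norm bound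
  limits their sum of squares.\<close>

lemma ndl_graph_large_degree_card:
  assumes ndl: "ndl_graph n d l G" and d: "d > 0" and n: "n > 0" and U: "U \<subseteq> pverts G"
  defines "m \<equiv> real (card U)"
  defines "T \<equiv> {v \<in> U. real (card {u \<in> U. (v, u) \<in> parcs G}) > 2 * (real d * m / real n)}"
  shows "real (card T) / m \<le> (real n * l / real d / m)\<^sup>2"
\<comment> \<open>For \<open>m = 0\<close> both sides are 0 because division by zero yields
  0.\<close>
proof (cases "m = 0")
  case False
  interpret pair_graph G using ndl by (simp add: ndl_graph_def)
  have fin: "finite (pverts G)" by (rule pair_finite_verts)
  have finU: "finite U" using U fin by (rule finite_subset)
  have m: "m > 0" using False by (simp add: m_def)
  define q where "q = real d * m / real n"
  have q: "q > 0" using d n m by (simp add: q_def)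
  define g :: "'a \<Rightarrow> real" where "g u = of_bool (u \<in> U)" for u
  define a :: "'a \<Rightarrow> 'a \<Rightarrow> real" where "a u v = of_bool ((u, v) \<in> parcs G)" for u v
  note form = ndl_graph_form_bound[OF ndl d n]
  have row: "(\<Sum>u\<in>pverts G. (a v u - real d / real n) * g u) = real (card {u \<in> U. (v, u) \<in> parcs G}) - q" for v
  proof -
    have "(\<Sum>u\<in>pverts G. (a v u - real d / real n) * g u) = (\<Sum>u\<in>U. a v u - real d / real n)"
      using U fin by (intro sum.mono_neutral_cong_right) (auto simp: g_def)
    also have "\<dots> = (\<Sum>u\<in>U. a v u) - q"
      by (simp add: sum_subtractf q_def m_def)
    also have "(\<Sum>u\<in>U. a v u) = real (card {u \<in> U. (v, u) \<in> parcs G})"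
      using finU by (simp add: a_def of_bool_def sum.If_cases Int_def)
    finally show ?thesis .
  qed
  have "real (card T) * q\<^sup>2 = (\<Sum>v\<in>T. q\<^sup>2)" by simp
  \<comment> \<open>The cutoff is \<open>2 * q\<close>, so every vertex of \<open>T\<close> deviates
    from \<open>q\<close> by more than \<open>q\<close>.\<close>
  also have "\<dots> \<le> (\<Sum>v\<in>T. (\<Sum>u\<in>pverts G. (a v u - real d / real n) * g u)\<^sup>2)"
    unfolding row using q by (intro sum_mono power_mono) (auto simp: T_def q_def)
  also have "\<dots> \<le> (\<Sum>v\<in>pverts G. (\<Sum>u\<in>pverts G. (a v u - real d / real n) * g u)\<^sup>2)"
    using fin U by (intro sum_mono2) (auto simp: T_def)
  also have "\<dots> \<le> l\<^sup>2 * (\<Sum>v\<in>pverts G. (g v)\<^sup>2)"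
    using form arcs_symmetric unfolding a_def
    by (intro symmetric_form_bound_norm) auto
  also have "(\<Sum>v\<in>pverts G. (g v)\<^sup>2) = (\<Sum>v\<in>U. 1)"
    using U fin by (intro sum.mono_neutral_cong_right) (auto simp: g_def)
  also have "\<dots> = m" by (simp add: m_def)
  finally have "real (card T) \<le> l\<^sup>2 * m / q\<^sup>2"
    using q by (simp add: pos_le_divide_eq)
  then have "real (card T) / m \<le> l\<^sup>2 * m / q\<^sup>2 / m"
    using m by (intro divide_right_mono) auto
  also have "\<dots> = (real n * l / real d / m)\<^sup>2"
    using m d n by (simp add: q_def field_simps power2_eq_square)
  finally show ?thesis .
qed simp

text \<open>The 4 in the degree hypothesis is the cutoff factor 2 times another 2 for passing from
  the size of \<open>U\<close> to that of the trimmed set.\<close>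

lemma H3_minus_le_of_degree_le:
  assumes ndl: "ndl_graph n d l G" and d: "d > 0" and n: "n > 0" and W: "W \<subseteq> pverts G"
  defines "m \<equiv> real (card W)"
  assumes deg: "\<And>x. x \<in> W \<Longrightarrow> real (card {y \<in> W. (x, y) \<in> parcs G}) \<le> 4 * (real d * m / real n)"
  shows "real (H3_minus G W) \<le>
    8192 * (m ^ 6 * real d ^ 7 / real n ^ 7 + l ^ 4 * (m ^ 2 * real d / real n))"
proof -
  interpret pair_graph G using ndl by (simp add: ndl_graph_def)
  have l: "l > 0" using ndl_graph_form_bound(1)[OF ndl d n] .
  define r where "r = real d / real n"
  have "pverts G \<noteq> {}" using n ndl by (auto simp: ndl_graph_def)
  then obtain v where "v \<in> pverts G" by auto
  then have "d \<le> card (pverts G)"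
    using ndl_graph_degree[OF ndl, of v] pair_finite_verts
    by (metis (no_types, lifting) card_mono mem_Collect_eq subsetI)
  \<comment> \<open>A neighbourhood has at most \<open>n\<close> vertices. The bound
    \<open>r \<le> 1\<close> later permits replacing \<open>r ^ 9\<close> by
    \<open>r ^ 7\<close>.\<close>
  then have r: "0 \<le> r" "r \<le> 1" using n ndl by (auto simp: r_def ndl_graph_def)
  have m: "m \<ge> 0" by (simp add: m_def)
  have pow4: "(x + y) ^ 4 \<le> 8 * (x ^ 4 + y ^ 4)" for x y :: real
  proof -
    have sq: "(u + v)\<^sup>2 \<le> 2 * (u\<^sup>2 + v\<^sup>2)" for u v :: real
      using sum_squares_bound[of u v] by (simp add: power2_sum)
    have "((x + y)\<^sup>2)\<^sup>2 \<le> (2 * (x\<^sup>2 + y\<^sup>2))\<^sup>2" by (intro power_mono sq) auto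
    also have "\<dots> = 4 * (x\<^sup>2 + y\<^sup>2)\<^sup>2" by (simp only: power_mult_distrib) simp
    also have "\<dots> \<le> 4 * (2 * ((x\<^sup>2)\<^sup>2 + (y\<^sup>2)\<^sup>2))" by (intro mult_left_mono sq) auto
    finally show ?thesis by simp
  qed
  have "real (H3_minus G W) \<le> m * (4 * (real d * m / real n) * (real d * (4 * (real d * m / real n)) / real n + l) ^ 4)"
    unfolding m_def by (rule H3_minus_le_max_degree[OF ndl d n W]) (use deg m_def in auto)
  also have "\<dots> = m * (4 * (r * m) * (4 * (r\<^sup>2 * m) + l) ^ 4)"
    by (simp add: r_def power2_eq_square mult_ac)
  also have "\<dots> \<le> m * (4 * (r * m) * (8 * ((4 * (r\<^sup>2 * m)) ^ 4 + l ^ 4)))"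
    using m r by (intro mult_left_mono pow4) auto
  \<comment> \<open>Here \<open>8192 = 4 * 8 * 4 ^ 4\<close>: the degree factor, the constant of
    \<open>pow4\<close>, and the fourth power of the inner 4.\<close>
  also have "\<dots> = 8192 * (r ^ 9 * m ^ 6) + 32 * (l ^ 4 * (m ^ 2 * r))"
    by (simp add: power_mult_distrib algebra_simps flip: power_add power_mult)
      (simp add: power2_eq_square eval_nat_numeral)
  also have "\<dots> \<le> 8192 * (r ^ 7 * m ^ 6) + 8192 * (l ^ 4 * (m ^ 2 * r))"
    using r m l by (intro add_mono mult_left_mono mult_right_mono power_decreasing) auto
  finally show ?thesis by (simp add: r_def power_divide algebra_simps)
qed

theorem theorem3p7:
  fixes G :: "nat \<Rightarrow> 'a pair_pre_digraph"
    and n d :: "nat \<Rightarrow> nat"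
    and l :: "nat \<Rightarrow> real"
    and U :: "nat \<Rightarrow> 'a set"
  assumes "\<And>k. ndl_graph (n k) (d k) (l k) (G k)"
    and "\<And>k. 0 < d k"
    and "filterlim n at_top sequentially"
    and "\<And>k. U k \<subseteq> pverts (G k)"
    and "(\<lambda>k. real (n k) * l k / real (d k)) \<in> o(\<lambda>k. real (card (U k)))"
  shows "\<exists>U' :: nat \<Rightarrow> 'a set.
      (\<forall>k. U' k \<subseteq> U k) \<and>
      (\<exists>\<epsilon> :: nat \<Rightarrow> real. \<epsilon> \<in> o(\<lambda>_. 1) \<and>
         (\<forall>k. real (card (U' k)) = (1 - \<epsilon> k) * real (card (U k)))) \<and>
      (\<lambda>k. real (H3_minus (G k) (U' k))) \<in> O(\<lambda>k.
           real (card (U' k)) ^ 6 * real (d k) ^ 7 / real (n k) ^ 7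
         + l k ^ 2 * (real (card (U' k)) ^ 4 * real (d k) ^ 4 / real (n k) ^ 4)
         + l k * (real (card (U' k)) ^ 5 * real (d k) ^ 5 / real (n k) ^ 5)
         + l k ^ 2 * (real (card (U' k)) ^ 4 * real (d k) powr (7/2) / real (n k) powr (7/2))
         + l k ^ 3 * (real (card (U' k)) ^ 3 * real (d k) powr (5/2) / real (n k) powr (5/2))
         + l k ^ 4 * (real (card (U' k)) ^ 2 * real (d k) / real (n k)))"
proof -
  define m where "m k = real (card (U k))" for k
  define T where "T k = {v \<in> U k. real (card {u \<in> U k. (v, u) \<in> parcs (G k)})
      > 2 * (real (d k) * m k / real (n k))}" for k
  define U' where "U' k = U k - T k" for k
  define m' where "m' k = real (card (U' k))" for k
  \<comment> \<open>For empty \<open>U k\<close> this is 0 by the division convention, so the size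
    identity holds for every \<open>k\<close> and not only eventually.\<close>
  define \<epsilon> where "\<epsilon> k = real (card (T k)) / m k" for k
  have finU: "finite (U k)" for k
  proof -
    interpret pair_graph "G k" using assms(1) by (simp add: ndl_graph_def)
    show ?thesis using assms(4) pair_finite_verts by (rule finite_subset)
  qed
  have m': "m' k = (1 - \<epsilon> k) * m k" for k
  proof -
    have "T k \<subseteq> U k" by (auto simp: T_def)
    then have "m' k = m k - real (card (T k))"
      unfolding m'_def m_def U'_def using finU
      by (simp add: card_Diff_subset finite_subset of_nat_diff card_mono)
    moreover have "m k = 0 \<Longrightarrow> card (T k) = 0"
      using finU[of k] \<open>T k \<subseteq> U k\<close> by (auto simp: m_def)
    ultimately show ?thesis by (auto simp: \<epsilon>_def field_simps)
  qed
  have npos: "eventually (\<lambda>k. n k > 0) sequentially"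
    using assms(3) eventually_gt_at_top[of 0] by (rule eventually_compose_filterlim[rotated])
  have "((\<lambda>k. real (n k) * l k / real (d k) / m k) \<longlongrightarrow> 0) sequentially"
    using smalloD_tendsto[OF assms(5)] by (simp add: m_def)
  then have "((\<lambda>k. (real (n k) * l k / real (d k) / m k)\<^sup>2) \<longlongrightarrow> 0) sequentially"
    by (simp add: tendsto_null_power)
  then have \<epsilon>0: "\<epsilon> \<longlonglongrightarrow> 0"
  proof (rule tendsto_sandwich[OF _ _ tendsto_const, rotated 2])
    show "eventually (\<lambda>k. 0 \<le> \<epsilon> k) sequentially" by (simp add: \<epsilon>_def m_def)
    show "eventually (\<lambda>k. \<epsilon> k \<le> (real (n k) * l k / real (d k) / m k)\<^sup>2) sequentially"
      using npos unfolding \<epsilon>_def T_def m_def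
      by eventually_elim (rule ndl_graph_large_degree_card[OF assms(1,2) _ assms(4)])
  qed
  \<comment> \<open>Eventually at least half of \<open>U k\<close> survives, so degree bounds in
    terms of \<open>m k\<close> become bounds in terms of \<open>m' k\<close>.\<close>
  have half: "eventually (\<lambda>k. \<epsilon> k < 1 / 2) sequentially"
    using \<epsilon>0 by (rule order_tendstoD) simp
  define F where "F k = m' k ^ 6 * real (d k) ^ 7 / real (n k) ^ 7
         + l k ^ 2 * (m' k ^ 4 * real (d k) ^ 4 / real (n k) ^ 4)
         + l k * (m' k ^ 5 * real (d k) ^ 5 / real (n k) ^ 5)
         + l k ^ 2 * (m' k ^ 4 * real (d k) powr (7/2) / real (n k) powr (7/2))
         + l k ^ 3 * (m' k ^ 3 * real (d k) powr (5/2) / real (n k) powr (5/2))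
         + l k ^ 4 * (m' k ^ 2 * real (d k) / real (n k))" for k
  have "(\<lambda>k. real (H3_minus (G k) (U' k))) \<in> O(F)"
  proof (rule bigoI[of _ 8192], use npos half in eventually_elim)
    case (elim k)
    have l: "l k > 0" using ndl_graph_form_bound(1)[OF assms(1,2) elim(1)] .
    have mm': "m k \<le> 2 * m' k"
    proof -
      have "1 / 2 * m k \<le> (1 - \<epsilon> k) * m k"
        using elim(2) by (intro mult_right_mono) (auto simp: m_def)
      then show ?thesis by (simp add: m')
    qed
    have "real (H3_minus (G k) (U' k)) \<le> 8192 * (m' k ^ 6 * real (d k) ^ 7 / real (n k) ^ 7
        + l k ^ 4 * (m' k ^ 2 * real (d k) / real (n k)))"
      unfolding m'_def
    proof (rule H3_minus_le_of_degree_le[OF assms(1,2) elim(1)])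
      show "U' k \<subseteq> pverts (G k)" using assms(4)[of k] by (auto simp: U'_def)
      fix x assume x: "x \<in> U' k"
      have "card {y \<in> U' k. (x, y) \<in> parcs (G k)} \<le> card {u \<in> U k. (x, u) \<in> parcs (G k)}"
        using finU[of k] by (intro card_mono) (auto simp: U'_def)
      then have "real (card {y \<in> U' k. (x, y) \<in> parcs (G k)}) \<le> 2 * (real (d k) * m k / real (n k))"
        using x by (auto simp: U'_def T_def)
      also have "\<dots> \<le> 2 * (real (d k) * (2 * m' k) / real (n k))"
        using mm' by (intro mult_left_mono divide_right_mono) auto
      finally show "real (card {y \<in> U' k. (x, y) \<in> parcs (G k)})
          \<le> 4 * (real (d k) * real (card (U' k)) / real (n k))"
        by (simp add: m'_def)
    qed
    \<comment> \<open>As \<open>l k > 0\<close>, all six summands of \<open>F k\<close> are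
      nonnegative, and the two on the left are the first and the last of them.\<close>
    also have "\<dots> \<le> 8192 * F k"
      using l by (simp add: F_def m'_def)
    also have "\<dots> \<le> 8192 * norm (F k)" by simp
    finally show ?case by simp
  qed
  moreover have "\<epsilon> \<in> o(\<lambda>_. 1)" using \<epsilon>0 by (intro smalloI_tendsto) auto
  ultimately show ?thesis
    using m' unfolding F_def m_def m'_def
    by (intro exI[of _ U'] conjI exI[of _ \<epsilon>] allI) (auto simp: U'_def)
qed

end
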